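(* Let $t$ be a positive integer. (a) Assume $3t(t+1)$ is not of the form $l(l+1)$ for any $l\in\mathbb{N}$. Then the interval $[12t-1,\,6t(t+1)-1]$ contains an integer $n\equiv 3\pmod 4$ with $a_3^+(n)$ odd. (b) Assume $6t(2t+1)$ is not of the form $l(l+1)$ for any $l\in\mathbb{N}$. Then the interval $[24t-1,\,12t(2t+1)-1]$ contains an integer $n\equiv 3\pmod 4$ with $a_3^+(n)$ even. In particular, there are infinitely many integers $n\equiv 3\pmod 4$ for which $c_3^+(n)$ is even, and infinitely many integers $n\equiv 3\pmod 4$ for which $c_3^+(n)$ is odd.
   Context: Let $q=e^{2\pi i z}$ with $z$ in the upper half-plane, and $\eta(z)=q^{1/24}\prod_{n\ge1}(1-q^n)$. Define $f_3^+(z)=\left(\frac{\eta(z)}{\eta(3z)}\right)^{12}=\sum_{n\ge -1}a_3^+(n)q^n$ (so $a_3^+(n)=0$ for $n<-1$ and $a_3^+(-1)=1$). Define $j_3^+(z)=\left(\frac{\eta(z)}{\eta(3z)}\right)^{12}+12+3^6\left(\frac{\eta(3z)}{\eta(z)}\right)^{12}$ and let $c_3^+(n)$ be the coefficient of $q^n$ in its $q$-expansion. *)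

theory Defs
  imports "HOL-Complex_Analysis.Complex_Analysis" "HOL-Number_Theory.Cong"
begin

definition nome :: "complex \<Rightarrow> complex" where
  "nome z = exp (2 * of_real pi * \<i> * z)"

text \<open>The exponential is the branch of \<open>q\<^sup>1\<^sup>/\<^sup>2\<^sup>4\<close> meant in the eta function.\<close>

definition dedekind_eta :: "complex \<Rightarrow> complex" where
  "dedekind_eta z = exp (2 * of_real pi * \<i> * z / 24) * (\<Prod>n. 1 - nome z ^ Suc n)"

definition f3_plus :: "complex \<Rightarrow> complex" where
  "f3_plus z = (dedekind_eta z / dedekind_eta (3 * z)) ^ 12"

definition j3_plus :: "complex \<Rightarrow> complex" where
  "j3_plus z = (dedekind_eta z / dedekind_eta (3 * z)) ^ 12 + 12
     + 3 ^ 6 * (dedekind_eta (3 * z) / dedekind_eta z) ^ 12"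

text \<open>
  A \<open>q\<close>-expansion is a Laurent series in \<open>q\<close> with finite principal part that represents the
  function on the whole upper half-plane. The bound on the radius of convergence is needed
  because the value of \<^const>\<open>eval_fls\<close> is unspecified where the series diverges.
\<close>

definition has_q_expansion :: "(complex \<Rightarrow> complex) \<Rightarrow> complex fls \<Rightarrow> bool" where
  "has_q_expansion f F \<longleftrightarrow>
     fls_conv_radius F \<ge> 1 \<and> (\<forall>z. Im z > 0 \<longrightarrow> eval_fls F (nome z) = f z)"

lemma has_q_expansion_unique:
  assumes "has_q_expansion f F" "has_q_expansion f G"
  shows "F = G"
proof -
  have eq: "eval_fls F w = eval_fls G w" if w: "w \<noteq> 0" "norm w < 1" for w
  proof -
    define z where "z = Ln w / (2 * of_real pi * \<i>)"
    have "nome z = w"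
      using w by (simp add: nome_def z_def)
    moreover have "Im z = - ln (norm w) / (2 * pi)"
    proof -
      have "z = - \<i> * Ln w / of_real (2 * pi)"
        by (simp add: z_def field_simps)
      thus ?thesis
        using w by (simp add: Im_divide_of_real)
    qed
    hence "Im z > 0"
      using w by (simp add: divide_neg_pos ln_less_zero)
    ultimately show ?thesis
      using assms unfolding has_q_expansion_def by auto
  qed
  have "eventually (\<lambda>w. w \<in> ball 0 1 - {0 :: complex}) (at 0)"
    by (intro eventually_at_in_open) auto
  hence "eventually (\<lambda>w. eval_fls G w = eval_fls F w) (at 0)"
    by eventually_elim (use eq in auto)
  moreover have "fls_conv_radius F > 0" "fls_conv_radius G > 0"
    using assms unfolding has_q_expansion_def
    by (auto intro: less_le_trans[of 0 "1::ereal"])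
  ultimately have "eval_fls F has_laurent_expansion F" "eval_fls F has_laurent_expansion G"
    by (auto simp: has_laurent_expansion_def)
  thus ?thesis
    by (rule has_laurent_expansion_unique)
qed

definition q_coeff :: "(complex \<Rightarrow> complex) \<Rightarrow> int \<Rightarrow> complex" where
  "q_coeff f n = fls_nth (THE F. has_q_expansion f F) n"

definition a3_plus :: "int \<Rightarrow> complex" where
  "a3_plus = q_coeff f3_plus"

definition c3_plus :: "int \<Rightarrow> complex" where
  "c3_plus = q_coeff j3_plus"

text \<open>
  The coefficients are complex numbers by construction, so their parity includes the claim
  that they are integers; neither predicate is the negation of the other.
\<close>

definition odd_integer :: "complex \<Rightarrow> bool" where
  "odd_integer x \<longleftrightarrow> (\<exists>k::int. odd k \<and> x = of_int k)"

definition even_integer :: "complex \<Rightarrow> bool" where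
  "even_integer x \<longleftrightarrow> (\<exists>k::int. even k \<and> x = of_int k)"

end

theory Submission
  imports Defs "HOL-Library.Z2"
begin

text \<open>
  Since \<open>(1 - x) ^ 12\<close> and \<open>(1 - x ^ 4) ^ 3\<close> agree modulo 2, the coefficients \<open>a(n)\<close> of \<open>f3_plus\<close>
  satisfy \<open>a(4 m - 1) \<equiv> b(m)\<close>, where \<open>b\<close> has the generating function \<open>(P(Q) / P(Q ^ 3)) ^ 3\<close> over
  the field with two elements and \<open>P(Q) = \<Prod>(1 - Q ^ n)\<close>. By Gauss's identity for triangular
  numbers, \<open>P(Q) ^ 3\<close> is the sum of all \<open>Q ^ (k (k + 1) / 2)\<close> modulo 2. Comparing the coefficients of
  \<open>Q ^ (3 t (t + 1) / 2)\<close>, a non-triangular exponent, the sum of the \<open>b(3 t (t + 1) / 2 - 3 k (k + 1) / 2)\<close>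
  over \<open>k \<le> t\<close> vanishes. The term \<open>k = t\<close> is \<open>b(0) = 1\<close>, so the other \<open>t\<close> terms cannot all be 0,
  and if \<open>t\<close> is even they cannot all be 1 either. Finally, \<open>1 / f3_plus\<close> is modulo 2 a series
  in exponents congruent to 1 modulo 4, so it does not affect the parity of the coefficients of
  \<open>j3_plus\<close> at exponents congruent to 3.
\<close>

unbundle no vec_syntax

subsection \<open>Gauss's identity for triangular numbers modulo 2\<close>

lemma two_triangle: "2 * triangle n = n * (n + 1)"
  by (simp add: triangle_def)

lemma strict_mono_triangle: "strict_mono triangle"
  by (simp add: strict_mono_Suc_iff)

lemma triangle_eq_iff [simp]: "triangle m = triangle n \<longleftrightarrow> m = n"
  using strict_mono_triangle by (simp add: strict_mono_eq)

lemma triangle_le_iff [simp]: "triangle m \<le> triangle n \<longleftrightarrow> m \<le> n"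
  using strict_mono_triangle by (simp add: strict_mono_less_eq)

lemma le_triangle: "n \<le> triangle n"
  by (induction n) auto

text \<open>
  Shanks's finite form of Gauss's identity for triangular numbers, cleared of denominators. As formal
  power series in \<open>x\<close>, all summands but the one with \<open>s = 0\<close> are divisible by \<open>x ^ (2 * n + 1)\<close>.
\<close>

definition shanks_summand :: "'a::comm_ring_1 \<Rightarrow> nat \<Rightarrow> nat \<Rightarrow> 'a" where
  "shanks_summand x n s =
     (\<Prod>j=s..<n. 1 - x ^ (2 * j + 2)) * (\<Prod>j<s. 1 - x ^ (2 * j + 1)) * x ^ (s * (2 * n + 1))"

text \<open>A telescoping certificate: the right side is \<open>V (s + 1) - V s\<close> with
  \<open>V s = (1 - x ^ (2 * s)) * shanks_summand x n s\<close>. At \<open>s = n\<close> the formal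
  value of the product over \<open>j\<close> from \<open>n + 1\<close> to \<open>n - 1\<close> would
  be \<open>1 / (1 - x ^ (2 * n + 2))\<close>, which cancels the factor in front; the case
  distinction records this cancelled value.\<close>

lemma shanks_summand_diff:
  assumes "s \<le> n"
  shows "shanks_summand x (Suc n) s - (1 - x ^ (2 * n + 1)) * shanks_summand x n s =
           (if s = n then (\<Prod>j<Suc n. 1 - x ^ (2 * j + 1)) * x ^ (Suc n * (2 * n + 1))
            else (1 - x ^ (2 * Suc s)) * shanks_summand x n (Suc s)) -
           (1 - x ^ (2 * s)) * shanks_summand x n s"
proof -
  define A where "A = (\<Prod>j=s..<n. 1 - x ^ (2 * j + 2))"
  define D where "D = (\<Prod>j<s. 1 - x ^ (2 * j + 1))"
  have *: "shanks_summand x (Suc n) s =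
          A * D * x ^ (s * (2 * n + 1)) * ((1 - x ^ (2 * n + 2)) * x ^ (2 * s))"
  proof -
    have "x ^ (s * (2 * Suc n + 1)) = x ^ (s * (2 * n + 1)) * x ^ (2 * s)"
      by (simp add: algebra_simps flip: power_add)
    thus ?thesis
      using assms by (simp add: shanks_summand_def A_def D_def mult_ac)
  qed
  have **: "(if s = n then (\<Prod>j<Suc n. 1 - x ^ (2 * j + 1)) * x ^ (Suc n * (2 * n + 1))
            else (1 - x ^ (2 * Suc s)) * shanks_summand x n (Suc s)) =
          A * D * x ^ (s * (2 * n + 1)) * ((1 - x ^ (2 * s + 1)) * x ^ (2 * n + 1))"
  proof (cases "s = n")
    case True
    have "x ^ (Suc n * (2 * n + 1)) = x ^ (n * (2 * n + 1)) * x ^ (2 * n + 1)"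
      by (simp add: algebra_simps flip: power_add)
    thus ?thesis
      using True by (simp add: A_def D_def mult_ac)
  next
    case False
    hence "A = (1 - x ^ (2 * s + 2)) * (\<Prod>j=Suc s..<n. 1 - x ^ (2 * j + 2))"
      using assms unfolding A_def by (subst prod.atLeast_Suc_lessThan) auto
    thus ?thesis
      using False by (simp add: shanks_summand_def D_def power_add mult_ac)
  qed
  have ***: "shanks_summand x n s = A * D * x ^ (s * (2 * n + 1))"
    by (simp add: shanks_summand_def A_def D_def)
  \<comment> \<open>What is left after the common factor
    \<open>A * D * x ^ (s * (2 * n + 1))\<close> is taken out; both sides expand to the same four
    monomials.\<close>
  have "(1 - x ^ (2 * n + 2)) * x ^ (2 * s) - (1 - x ^ (2 * n + 1)) =
        (1 - x ^ (2 * s + 1)) * x ^ (2 * n + 1) - (1 - x ^ (2 * s))"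
    by (simp add: algebra_simps flip: power_add)
  moreover have "t * u - c * t = t * v - d * t" if "u - c = v - d" for t u c v d :: 'a
  proof -
    have "t * u - c * t = t * (u - c)" "t * v - d * t = t * (v - d)"
      by (simp_all add: right_diff_distrib mult.commute)
    thus ?thesis
      using that by simp
  qed
  ultimately show ?thesis
    unfolding * ** *** by blast
qed

text \<open>Induction on \<open>n\<close>: the telescoping sum over \<open>s <= n\<close> supplies
  the term with \<open>triangle (2 * n + 1)\<close>, and the new summand \<open>s = n + 1\<close>
  the one with \<open>triangle (2 * n + 2)\<close>.\<close>

lemma shanks_identity:
  "(\<Sum>s\<le>n. shanks_summand x n s) =
     (\<Prod>j<n. 1 - x ^ (2 * j + 1)) * (\<Sum>k\<le>2 * n. x ^ triangle k)"
proof (induction n)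
  case 0
  show ?case by (simp add: shanks_summand_def)
next
  case (Suc n)
  define D where "D = (\<Prod>j<Suc n. 1 - x ^ (2 * j + 1))"
  define V where "V s = (if s = Suc n then D * x ^ (Suc n * (2 * n + 1))
     else (1 - x ^ (2 * s)) * shanks_summand x n s)" for s
  have "(\<Sum>s\<le>n. shanks_summand x (Suc n) s - (1 - x ^ (2 * n + 1)) * shanks_summand x n s) =
        (\<Sum>s\<le>n. V (Suc s) - V s)"
    by (intro sum.cong refl, subst shanks_summand_diff) (auto simp: V_def D_def)
  also have "\<dots> = V (Suc n) - V 0"
    by (simp only: lessThan_Suc_atMost [symmetric] sum_lessThan_telescope)
  also have "\<dots> = D * x ^ (Suc n * (2 * n + 1))"
    by (simp add: V_def)
  also have "Suc n * (2 * n + 1) = triangle (2 * n + 1)"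
    using two_triangle[of "2 * n + 1"] by simp
  finally have "(\<Sum>s\<le>n. shanks_summand x (Suc n) s) =
      (1 - x ^ (2 * n + 1)) * (\<Sum>s\<le>n. shanks_summand x n s) + D * x ^ triangle (2 * n + 1)"
    by (simp only: sum_subtractf sum_distrib_left [symmetric] diff_eq_eq add.commute)
  also have "(1 - x ^ (2 * n + 1)) * (\<Sum>s\<le>n. shanks_summand x n s) =
      D * (\<Sum>k\<le>2 * n. x ^ triangle k)"
    by (subst Suc.IH) (simp add: D_def mult_ac)
  finally have "(\<Sum>s\<le>n. shanks_summand x (Suc n) s) =
      D * (\<Sum>k\<le>2 * n + 1. x ^ triangle k)"
    by (simp add: ring_distribs)
  moreover have "shanks_summand x (Suc n) (Suc n) = D * x ^ triangle (2 * Suc n)"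
  proof -
    have "triangle (2 * Suc n) = Suc n * (2 * Suc n + 1)"
      using two_triangle[of "2 * Suc n"] by simp
    thus ?thesis
      by (simp only: shanks_summand_def D_def) simp
  qed
  ultimately have "(\<Sum>s\<le>Suc n. shanks_summand x (Suc n) s) =
      D * (\<Sum>k\<le>Suc (2 * n + 1). x ^ triangle k)"
    by (simp add: ring_distribs)
  thus ?case
    by (simp add: D_def)
qed

section \<open>Integer power series, change of coefficients and substitution of powers\<close>

definition map_fps :: "('a \<Rightarrow> 'b) \<Rightarrow> 'a fps \<Rightarrow> 'b fps" where
  "map_fps h f = Abs_fps (\<lambda>n. h (f $ n))"

lemma map_fps_nth [simp]: "map_fps h f $ n = h (f $ n)"
  by (simp add: map_fps_def)

text \<open>At type \<open>bit\<close> this is reduction modulo 2, at type \<open>complex\<close> an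
  embedding. One integer series thus connects the analytic expansion with its parity.\<close>

abbreviation fps_of_int :: "int fps \<Rightarrow> 'a::ring_1 fps" where
  "fps_of_int \<equiv> map_fps of_int"

lemma fps_of_int_1 [simp]: "fps_of_int 1 = 1"
  by (simp add: fps_eq_iff)

lemma fps_of_int_X [simp]: "fps_of_int fps_X = fps_X"
  by (simp add: fps_eq_iff fps_X_def)

lemma fps_of_int_diff: "fps_of_int (f - g) = fps_of_int f - fps_of_int g"
  by (simp add: fps_eq_iff)

lemma fps_of_int_mult: "fps_of_int (f * g) = fps_of_int f * fps_of_int g"
  by (simp add: fps_eq_iff fps_mult_nth)

lemma fps_of_int_power: "fps_of_int (f ^ n) = fps_of_int f ^ n"
  by (induction n) (simp_all add: fps_of_int_mult)

lemma fps_of_int_prod: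
  "fps_of_int (\<Prod>i\<in>A. f i) = (\<Prod>i\<in>A. fps_of_int (f i) :: 'a::comm_ring_1 fps)"
  by (induction A rule: infinite_finite_induct) (simp_all add: fps_of_int_mult)

lemma fps_of_int_compose: "fps_of_int (f oo g) = fps_of_int f oo fps_of_int g"
  by (simp add: fps_eq_iff fps_compose_nth flip: fps_of_int_power)

lemma fps_compose_X_power_nth:
  fixes f :: "'a::comm_ring_1 fps"
  assumes "d > 0"
  shows "(f oo fps_X ^ d) $ n = (if d dvd n then f $ (n div d) else 0)"
proof -
  have *: "(f oo fps_X ^ d) $ n = (\<Sum>i=0..n. if d * i = n then f $ i else 0)"
    by (auto simp: fps_compose_nth fps_X_power_nth intro!: sum.cong simp flip: power_mult)
  show ?thesis
  proof (cases "d dvd n")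
    case True
    then obtain k where k: "n = d * k" ..
    have "(\<Sum>i=0..n. if d * i = n then f $ i else 0) = (\<Sum>i=0..n. if i = k then f $ i else 0)"
      using assms by (intro sum.cong) (auto simp: k)
    thus ?thesis
      using assms * by (simp add: k)
  next
    case False
    thus ?thesis
      unfolding * by (auto intro!: sum.neutral)
  qed
qed

lemma fps_mult_nth_cong:
  assumes "\<And>k. k \<le> n \<Longrightarrow> f $ k = f' $ k" "\<And>k. k \<le> n \<Longrightarrow> g $ k = g' $ k"
  shows "(f * g) $ n = (f' * g') $ n"
  using assms by (simp add: fps_mult_nth)

lemma fps_power_nth_cong:
  assumes "\<And>k. k \<le> n \<Longrightarrow> f $ k = g $ k"
  shows "(f ^ m) $ n = (g ^ m) $ n"
  using assms by (induction m arbitrary: n) (auto intro!: fps_mult_nth_cong)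

section \<open>Euler's product and the triangular series as formal power series\<close>

text \<open>The infinite product is encoded by truncation: every factor after the first
  \<open>n\<close> is 1 up to terms of degree greater than \<open>n\<close>, so coefficient
  \<open>n\<close> is already final.\<close>

definition euler_fps :: "'a::comm_ring_1 fps" where
  "euler_fps = Abs_fps (\<lambda>n. (\<Prod>k<n. 1 - fps_X ^ Suc k) $ n)"

lemma euler_fps_nth:
  assumes "n \<le> N"
  shows "euler_fps $ n = (\<Prod>k<N. 1 - fps_X ^ Suc k) $ n"
  using assms
proof (induction N rule: dec_induct)
  case base
  show ?case by (simp add: euler_fps_def)
next
  case (step N)
  thus ?case
    by (simp add: algebra_simps fps_X_power_mult_nth fps_X_power_mult_right_nth del: power_Suc)
qed

lemma euler_fps_nth_0 [simp]: "euler_fps $ 0 = 1"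
  by (simp add: euler_fps_def)

lemma fps_of_int_euler [simp]: "fps_of_int euler_fps = (euler_fps :: 'a::comm_ring_1 fps)"
proof (rule fps_ext)
  fix n
  have "fps_of_int euler_fps $ n = (fps_of_int (\<Prod>k<n. 1 - fps_X ^ Suc k) :: 'a fps) $ n"
    by (simp add: euler_fps_def)
  thus "fps_of_int euler_fps $ n = (euler_fps :: 'a fps) $ n"
    by (simp add: euler_fps_def fps_of_int_prod fps_of_int_diff fps_of_int_power fps_of_int_mult)
qed

definition triangle_fps :: "bit fps" where
  "triangle_fps = Abs_fps (\<lambda>n. of_bool (n \<in> range triangle))"

lemma triangle_fps_nth:
  assumes "n \<le> N"
  shows "triangle_fps $ n = (\<Sum>k\<le>N. fps_X ^ triangle k) $ n"
proof -
  have "(\<Sum>k\<le>N. fps_X ^ triangle k :: bit fps) $ n = (\<Sum>k\<le>N. if n = triangle k then 1 else 0)"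
    by (simp add: fps_sum_nth fps_X_power_nth)
  also have "\<dots> = (\<Sum>k\<in>{k\<in>{..N}. n = triangle k}. 1)"
    by (subst sum.inter_filter [symmetric]) auto
  also have "\<dots> = of_bool (n \<in> range triangle)"
  proof (cases "n \<in> range triangle")
    case True
    then obtain k where "n = triangle k" ..
    moreover from this have "{j \<in> {..N}. n = triangle j} = {k}"
      using assms le_triangle[of k] by auto
    ultimately show ?thesis by simp
  next
    case False
    hence *: "{k \<in> {..N}. n = triangle k} = {}"
      by auto
    show ?thesis
      unfolding * sum.empty using False by simp
  qed
  finally show ?thesis
    by (simp add: triangle_fps_def)
qed

section \<open>Frobenius in characteristic 2 and Gauss's identity\<close>

lemma bit_fps_add_self [simp]: "f + f = (0 :: bit fps)"
  by (simp add: fps_eq_iff)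

lemma bit_fps_one_minus_square: "(1 - f) ^ 2 = 1 - (f ^ 2 :: bit fps)"
proof -
  have "(1 - f) ^ 2 - (1 - f ^ 2) = (f ^ 2 + f ^ 2) - (f + f)"
    by (simp only: power2_eq_square algebra_simps) simp
  thus ?thesis
    by (simp only: bit_fps_add_self diff_self right_minus_eq)
qed

text \<open>In the convolution the terms at \<open>i\<close> and \<open>n - i\<close> cancel in
  pairs. Only the diagonal \<open>2 * i = n\<close> survives, and there \<open>a * a = a\<close> in
  \<open>bit\<close>.\<close>

lemma bit_fps_square: "f ^ 2 = f oo (fps_X ^ 2 :: bit fps)"
proof (rule fps_ext)
  fix n
  define h where "h i = f $ i * f $ (n - i)" for i
  have "(f ^ 2) $ n = (\<Sum>i=0..n. h i)"
    by (simp add: power2_eq_square fps_mult_nth h_def)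
  also have "{0..n} = {i. 2 * i < n} \<union> {i. i \<le> n \<and> n < 2 * i} \<union> {i. 2 * i = n}"
    by auto
  also have "(\<Sum>i\<in>\<dots>. h i) = (\<Sum>i | 2 * i < n. h i) + (\<Sum>i | i \<le> n \<and> n < 2 * i. h i) +
                (\<Sum>i | 2 * i = n. h i)"
  proof -
    have fin: "finite {i. 2 * i < n}" "finite {i. i \<le> n \<and> n < 2 * i}" "finite {i. 2 * i = n}"
      by (auto intro!: finite_subset[of _ "{..n}"])
    show ?thesis
      using fin by (subst sum.union_disjoint; (subst sum.union_disjoint)?) auto
  qed
  also have "(\<Sum>i | i \<le> n \<and> n < 2 * i. h i) = (\<Sum>i | 2 * i < n. h i)"
    by (rule sum.reindex_bij_witness[of _ "\<lambda>i. n - i" "\<lambda>i. n - i"]) (auto simp: h_def mult_ac)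
  also have "(\<Sum>i | 2 * i = n. h i) = (\<Sum>i\<in>(if even n then {n div 2} else {}). h i)"
    by (intro sum.cong) auto
  also have "\<dots> = (if even n then f $ (n div 2) else 0)"
  proof -
    have "a * a = a" for a :: bit
      by (cases a) simp_all
    thus ?thesis
      by (auto simp only: h_def elim!: evenE split: if_splits) simp_all
  qed
  finally show "(f ^ 2) $ n = (f oo fps_X ^ 2) $ n"
    by (simp add: fps_compose_X_power_nth)
qed

lemma bit_fps_power4: "f ^ 4 = f oo (fps_X ^ 4 :: bit fps)"
proof -
  have "f ^ 4 = (f ^ 2) ^ 2"
    by (simp flip: power_mult)
  also have "\<dots> = f oo fps_X ^ 4"
  proof (rule fps_ext)
    fix n :: nat
    have "4 dvd n \<longleftrightarrow> even n \<and> even (n div 2)" "n div 2 div 2 = n div 4"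
      by presburger+
    thus "((f ^ 2) ^ 2) $ n = (f oo fps_X ^ 4) $ n"
      by (simp add: bit_fps_square[of f] bit_fps_square[of "f oo _"] fps_compose_X_power_nth)
  qed
  finally show ?thesis .
qed

text \<open>Gauss's product P(x^2)^2 / P(x) becomes P(x)^3 modulo 2. To avoid denominators, both
  sides are multiplied by P; each coefficient then depends only on finite products, to which
  Shanks's identity applies.\<close>

lemma triangle_fps_conv_euler: "triangle_fps = euler_fps ^ 3"
proof -
  have "(euler_fps * triangle_fps) $ n = (euler_fps ^ 4 :: bit fps) $ n" for n
  proof -
    define D :: "bit fps" where "D = (\<Prod>j<n. 1 - fps_X ^ (2 * j + 1))"
    define e :: "nat \<Rightarrow> bit fps" where "e N = (\<Prod>k<N. 1 - fps_X ^ Suc k)" for N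
    have e_sq: "e n ^ 2 = (\<Prod>j<n. 1 - fps_X ^ (2 * j + 2))"
      unfolding e_def prod_power_distrib
    proof (rule prod.cong)
      fix j
      show "(1 - fps_X ^ Suc j) ^ 2 = (1 - fps_X ^ (2 * j + 2) :: bit fps)"
        unfolding bit_fps_one_minus_square power_mult [symmetric] by (simp only: mult_Suc_right mult.commute) simp
    qed auto
    \<comment> \<open>The odd exponents below \<open>2 * n\<close> give \<open>D\<close>, the factor
      in Shanks's identity; the even ones give the square of \<open>e n\<close> modulo 2.\<close>
    have e_double: "e (2 * n) = D * e n ^ 2"
      unfolding e_sq unfolding D_def e_def by (induction n) (simp_all add: mult_ac)
    have "(euler_fps * triangle_fps) $ n = (e (2 * n) * (\<Sum>k\<le>2 * n. fps_X ^ triangle k)) $ n"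
      unfolding e_def by (intro fps_mult_nth_cong euler_fps_nth triangle_fps_nth) auto
    also have "e (2 * n) * (\<Sum>k\<le>2 * n. fps_X ^ triangle k) =
        e n ^ 2 * (\<Sum>s\<le>n. shanks_summand fps_X n s)"
      unfolding e_double shanks_identity D_def by (simp only: mult_ac)
    also have "(e n ^ 2 * (\<Sum>s\<le>n. shanks_summand fps_X n s)) $ n = (e n ^ 2 * e n ^ 2) $ n"
    proof (rule fps_mult_nth_cong)
      fix k assume k: "k \<le> n"
      \<comment> \<open>Only \<open>s = 0\<close> contributes up to degree \<open>n\<close>, and
        that summand is again the square of \<open>e n\<close>.\<close>
      have "shanks_summand fps_X n s $ k = (0 :: bit)" if "s > 0" for s
      proof -
        have "k < 1 * (2 * n + 1)"
          using k by simp
        also have "\<dots> \<le> s * (2 * n + 1)"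
          using that by (intro mult_right_mono) auto
        finally show ?thesis
          by (simp add: shanks_summand_def fps_X_power_mult_right_nth)
      qed
      hence "(\<Sum>s\<le>n. shanks_summand fps_X n s) $ k = (\<Sum>s\<in>{0}. shanks_summand fps_X n s $ k :: bit)"
        by (subst fps_sum_nth, intro sum.mono_neutral_right) auto
      also have "\<dots> = e n ^ 2 $ k"
        by (simp add: shanks_summand_def e_sq atLeast0LessThan)
      finally show "(\<Sum>s\<le>n. shanks_summand fps_X n s) $ k = e n ^ 2 $ k" .
    qed auto
    also have "e n ^ 2 * e n ^ 2 = e n ^ 4"
      by (simp flip: power_add)
    also have "e n ^ 4 $ n = euler_fps ^ 4 $ n"
      unfolding e_def by (intro fps_power_nth_cong euler_fps_nth [symmetric])
    finally show ?thesis .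
  qed
  hence "euler_fps * triangle_fps = (euler_fps ^ 4 :: bit fps)"
    by (simp add: fps_eq_iff)
  also have "\<dots> = euler_fps * euler_fps ^ 3"
    by (simp add: eval_nat_numeral)
  finally show ?thesis
    using euler_fps_nth_0[where 'a = bit] by (metis mult_cancel_left fps_zero_nth zero_neq_one)
qed

subsection \<open>The eta quotient modulo 2\<close>

lemma of_int_bit_eq_0_iff [simp]: "(of_int k :: bit) = 0 \<longleftrightarrow> even k"
  by (cases "even k") (auto elim!: evenE oddE)

lemma mult_compose_triangle_fps_nth:
  assumes "d > 0"
  shows "(f * (triangle_fps oo fps_X ^ d)) $ n =
           (\<Sum>k | d * triangle k \<le> n. f $ (n - d * triangle k))"
proof -
  have "(f * (triangle_fps oo fps_X ^ d)) $ n =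
          (\<Sum>i=0..n. f $ (n - i) * (triangle_fps oo fps_X ^ d) $ i)"
    unfolding fps_mult_nth by (rule sum.reindex_bij_witness[of _ "\<lambda>i. n - i" "\<lambda>i. n - i"]) auto
  also have "\<dots> = (\<Sum>i\<in>(\<lambda>k. d * triangle k) ` {k. d * triangle k \<le> n}. f $ (n - i))"
  proof (rule sum.mono_neutral_cong_right)
    show "\<forall>i\<in>{0..n} - (\<lambda>k. d * triangle k) ` {k. d * triangle k \<le> n}.
        f $ (n - i) * (triangle_fps oo fps_X ^ d) $ i = 0"
      using assms by (auto simp: fps_compose_X_power_nth triangle_fps_def image_iff elim!: dvdE)
  qed (use assms in \<open>auto simp: fps_compose_X_power_nth triangle_fps_def\<close>)
  also have "\<dots> = (\<Sum>k | d * triangle k \<le> n. f $ (n - d * triangle k))"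
    using assms by (subst sum.reindex) (auto simp: inj_on_def)
  finally show ?thesis .
qed

text \<open>If \<open>b\<close> were constantly \<open>c\<close> on the interval, the coefficient at
  \<open>3 * triangle t\<close> would be \<open>1 + t * c = 1\<close>, although this exponent is not
  triangular. The condition \<open>of_nat t * c = 0\<close> covers both uses: \<open>c = 0\<close>
  with any \<open>t\<close>, and \<open>c = 1\<close> with even \<open>t\<close>.\<close>

lemma ex_nth_neq_between_triangles:
  assumes b: "b * (triangle_fps oo fps_X ^ 3) = triangle_fps"
  assumes t: "3 * triangle t \<notin> range triangle" and c: "of_nat t * c = 0"
  shows "\<exists>m\<in>{3 * t..3 * triangle t}. b $ m \<noteq> c"
proof (rule ccontr)
  assume "\<not> ?thesis"
  hence const: "b $ m = c" if "3 * t \<le> m" "m \<le> 3 * triangle t" for m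
    using that by auto
  have "b $ 0 = 1"
  proof -
    have "triangle_fps $ 0 = 1"
      using rangeI[of triangle 0] by (simp add: triangle_fps_def)
    thus ?thesis
      using arg_cong[OF b, of "\<lambda>f. f $ 0"] by (simp add: fps_compose_X_power_nth)
  qed
  have "triangle_fps $ (3 * triangle t) =
     (\<Sum>k | 3 * triangle k \<le> 3 * triangle t. b $ (3 * triangle t - 3 * triangle k))"
    by (subst b [symmetric], rule mult_compose_triangle_fps_nth) simp
  also have "{k. 3 * triangle k \<le> 3 * triangle t} = insert t {..<t}"
    by auto
  also have "(\<Sum>k\<in>\<dots>. b $ (3 * triangle t - 3 * triangle k)) =
      b $ 0 + (\<Sum>k<t. b $ (3 * triangle t - 3 * triangle k))"
    by simp
  also have "(\<Sum>k<t. b $ (3 * triangle t - 3 * triangle k)) = (\<Sum>k<t. c)"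
  proof (intro sum.cong refl const)
    fix k assume "k \<in> {..<t}"
    \<comment> \<open>The exponent is smallest at \<open>k = t - 1\<close>, where it equals
      \<open>3 * t\<close>: this is the lower end of the interval.\<close>
    then obtain s where s: "t = Suc s" "k \<le> s"
      by (cases t) auto
    have "triangle k \<le> triangle s"
      using s by simp
    thus "3 * t \<le> 3 * triangle t - 3 * triangle k"
      unfolding s(1) triangle_Suc by arith
  qed auto
  also have "\<dots> = 0"
    using c by simp
  finally show False
    using t \<open>b $ 0 = 1\<close> by (simp add: triangle_fps_def)
qed

section \<open>Eta quotients as integer series and modulo 2\<close>

text \<open>The constant coefficient is 1, so inversion stays within \<open>int\<close>; the
  integrality of the coefficients of \<open>f3_plus\<close> and \<open>j3_plus\<close> rests on
  this.\<close>

definition euler_inv_fps :: "int fps" where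
  "euler_inv_fps = fps_left_inverse euler_fps 1"

text \<open>Here "cube" means the substitution of \<open>fps_X ^ 3\<close>, not a third
  power.\<close>

definition euler_cube_inv_fps :: "int fps" where
  "euler_cube_inv_fps = fps_left_inverse (euler_fps oo fps_X ^ 3) 1"

lemma euler_inv_fps: "euler_inv_fps * euler_fps = 1"
  by (simp add: euler_inv_fps_def fps_left_inverse)

lemma euler_cube_inv_fps: "euler_cube_inv_fps * (euler_fps oo fps_X ^ 3) = 1"
  by (simp add: euler_cube_inv_fps_def fps_left_inverse)

text \<open>The expansion of q * \<open>f3_plus\<close>, hence an index shift by one against
  \<open>a3_plus\<close>.\<close>

definition eta_quotient_fps :: "int fps" where
  "eta_quotient_fps = (euler_fps * euler_cube_inv_fps) ^ 12"

definition eta_quotient_inv_fps :: "int fps" where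
  "eta_quotient_inv_fps = ((euler_fps oo fps_X ^ 3) * euler_inv_fps) ^ 12"

definition eta_quotient_bit_fps :: "bit fps" where
  "eta_quotient_bit_fps = (euler_fps * fps_of_int euler_cube_inv_fps) ^ 3"

text \<open>A twelfth power is the fourth power of a cube, and taking fourth powers modulo 2 amounts
  to substituting \<open>fps_X ^ 4\<close>.\<close>

lemma fps_of_int_eta_quotient_bit:
  "fps_of_int eta_quotient_fps = eta_quotient_bit_fps oo fps_X ^ 4"
  by (simp add: eta_quotient_fps_def eta_quotient_bit_fps_def fps_of_int_power fps_of_int_mult
           flip: bit_fps_power4 power_mult)

lemma fps_of_int_euler_cube_inv:
  "fps_of_int euler_cube_inv_fps * (euler_fps oo fps_X ^ 3) = (1 :: 'a::idom fps)"
proof -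
  have "(fps_of_int (euler_cube_inv_fps * (euler_fps oo fps_X ^ 3)) :: 'a fps) = 1"
    by (simp add: euler_cube_inv_fps)
  thus ?thesis
    by (simp add: fps_of_int_mult fps_of_int_compose fps_of_int_power)
qed

lemma fps_of_int_euler_inv: "fps_of_int euler_inv_fps * euler_fps = (1 :: 'a::idom fps)"
proof -
  have "(fps_of_int (euler_inv_fps * euler_fps) :: 'a fps) = 1"
    by (simp only: euler_inv_fps fps_of_int_1)
  thus ?thesis
    by (simp add: fps_of_int_mult)
qed

text \<open>Gauss's identity is used twice, for P(Q)^3 and for P(Q^3)^3.\<close>

lemma eta_quotient_bit_mult:
  "eta_quotient_bit_fps * (triangle_fps oo fps_X ^ 3) = triangle_fps"
proof -
  have "eta_quotient_bit_fps * (triangle_fps oo fps_X ^ 3) =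
     euler_fps ^ 3 * (fps_of_int euler_cube_inv_fps * (euler_fps oo fps_X ^ 3)) ^ 3"
    by (simp add: eta_quotient_bit_fps_def triangle_fps_conv_euler fps_compose_power
          power_mult_distrib mult_ac)
  thus ?thesis
    by (simp add: fps_of_int_euler_cube_inv triangle_fps_conv_euler)
qed

lemma odd_eta_quotient_iff:
  "odd (eta_quotient_fps $ (4 * m)) \<longleftrightarrow> eta_quotient_bit_fps $ m = 1"
proof -
  have "of_int (eta_quotient_fps $ (4 * m)) = fps_of_int eta_quotient_fps $ (4 * m)"
    by simp
  also have "\<dots> = eta_quotient_bit_fps $ m"
    unfolding fps_of_int_eta_quotient_bit by (simp add: fps_compose_X_power_nth)
  finally show ?thesis
    by (metis bit_not_zero_iff of_int_bit_eq_0_iff zero_neq_one)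
qed

lemma even_eta_quotient_inv_nth:
  assumes "\<not> 4 dvd m"
  shows "even (eta_quotient_inv_fps $ m)"
proof -
  have "fps_of_int eta_quotient_inv_fps =
      ((((euler_fps oo fps_X ^ 3) * fps_of_int euler_inv_fps) ^ 3 :: bit fps) oo fps_X ^ 4)"
    by (simp add: eta_quotient_inv_fps_def fps_of_int_power fps_of_int_mult fps_of_int_compose
             flip: bit_fps_power4 power_mult)
  hence "fps_of_int eta_quotient_inv_fps $ m = (0 :: bit)"
    using assms by (simp add: fps_compose_X_power_nth)
  thus ?thesis
    by simp
qed

lemma ex_odd_eta_quotient:
  assumes "\<nexists>l::nat. 3 * t * (t + 1) = l * (l + 1)"
  shows "\<exists>m\<in>{3 * t..3 * triangle t}. odd (eta_quotient_fps $ (4 * m))"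
proof -
  have "3 * triangle t \<noteq> triangle l" for l
  proof
    assume "3 * triangle t = triangle l"
    hence "3 * t * (t + 1) = l * (l + 1)"
      using two_triangle[of t] two_triangle[of l] by simp
    thus False using assms by blast
  qed
  hence "\<exists>m\<in>{3 * t..3 * triangle t}. eta_quotient_bit_fps $ m \<noteq> 0"
    by (intro ex_nth_neq_between_triangles eta_quotient_bit_mult) auto
  thus ?thesis
    by (simp add: odd_eta_quotient_iff)
qed

lemma ex_even_eta_quotient:
  assumes "\<nexists>l::nat. 6 * t * (2 * t + 1) = l * (l + 1)"
  shows "\<exists>m\<in>{6 * t..3 * triangle (2 * t)}. even (eta_quotient_fps $ (4 * m))"
proof -
  have "3 * triangle (2 * t) \<noteq> triangle l" for l
  proof
    assume "3 * triangle (2 * t) = triangle l"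
    hence "6 * t * (2 * t + 1) = l * (l + 1)"
      using two_triangle[of "2 * t"] two_triangle[of l] by simp
    thus False using assms by blast
  qed
  \<comment> \<open>The parameter is doubled because an even number of ones sums to 0 in
    \<open>bit\<close>.\<close>
  hence "\<exists>m\<in>{3 * (2 * t)..3 * triangle (2 * t)}. eta_quotient_bit_fps $ m \<noteq> 1"
    by (intro ex_nth_neq_between_triangles eta_quotient_bit_mult) auto
  thus ?thesis
    by (simp add: odd_eta_quotient_iff[symmetric])
qed

subsection \<open>The \<open>q\<close>-expansions\<close>

definition euler_phi :: "complex \<Rightarrow> complex" where
  "euler_phi w = (\<Prod>n. 1 - w ^ Suc n)"

lemma convergent_prod_euler_phi:
  fixes w :: complex
  assumes "norm w < 1"
  shows "convergent_prod (\<lambda>n. 1 - w ^ Suc n)"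
proof (rule abs_convergent_prod_imp_convergent_prod)
  have "summable (\<lambda>n. norm (w ^ Suc n))"
    using assms by (subst summable_Suc_iff) (simp add: norm_power summable_geometric)
  thus "abs_convergent_prod (\<lambda>n. 1 - w ^ Suc n)"
    by (simp add: abs_convergent_prod_conv_summable)
qed

lemma euler_phi_nonzero:
  assumes "norm w < 1"
  shows "euler_phi w \<noteq> 0"
  unfolding euler_phi_def
proof (rule prodinf_nonzero)
  fix n
  have "norm (w ^ Suc n) < 1"
    using assms power_less_one_iff[of "norm w" "Suc n"] by (simp del: power_Suc add: norm_power)
  thus "1 - w ^ Suc n \<noteq> 0"
    by auto
qed (rule convergent_prod_euler_phi[OF assms])

text \<open>The deviations of the factors from 1 are dominated by a geometric series. Both
  holomorphy and the Taylor series of \<open>euler_phi\<close> are derived from this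
  convergence.\<close>

lemma uniform_limit_euler_phi:
  assumes "0 \<le> r" "r < 1"
  shows "uniform_limit (cball 0 r) (\<lambda>N w. \<Prod>n<N. 1 - w ^ Suc n) euler_phi sequentially"
proof -
  have "uniformly_convergent_on (cball 0 r) (\<lambda>N w. \<Sum>n<N. norm ((1 - w ^ Suc n) - 1 :: complex))"
  proof (rule Weierstrass_m_test'_ev)
    show "\<forall>\<^sub>F n in sequentially. \<forall>w\<in>cball 0 r. norm (norm ((1 - w ^ Suc n) - 1 :: complex)) \<le> r ^ Suc n"
      by (intro always_eventually) (auto simp: norm_power power_mono simp del: power_Suc)
    show "summable (\<lambda>n. r ^ Suc n)"
      using assms by (subst summable_Suc_iff) (simp add: summable_geometric)
  qed
  hence "uniformly_convergent_on (cball 0 r) (\<lambda>N w. \<Prod>n<N. 1 - w ^ Suc n :: complex)"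
    by (intro uniformly_convergent_on_prod') (auto intro!: continuous_intros)
  then obtain g where g: "uniform_limit (cball 0 r) (\<lambda>N w. \<Prod>n<N. 1 - w ^ Suc n :: complex) g sequentially"
    by (auto simp: uniformly_convergent_on_def)
  have "g w = euler_phi w" if "w \<in> cball 0 r" for w
  proof (rule LIMSEQ_unique)
    show "(\<lambda>N. \<Prod>n<N. 1 - w ^ Suc n) \<longlonglongrightarrow> g w"
      using tendsto_uniform_limitI[OF g that] .
    have "convergent_prod (\<lambda>n. 1 - w ^ Suc n)"
      using that assms by (intro convergent_prod_euler_phi) auto
    thus "(\<lambda>N. \<Prod>n<N. 1 - w ^ Suc n) \<longlonglongrightarrow> euler_phi w"
      unfolding euler_phi_def by (subst LIMSEQ_lessThan_iff_atMost) (rule convergent_prod_LIMSEQ)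
  qed
  hence "uniform_limit (cball 0 r) (\<lambda>N w. \<Prod>n<N. 1 - w ^ Suc n) g sequentially \<longleftrightarrow> ?thesis"
    by (intro uniform_limit_cong') auto
  with g show ?thesis
    by simp
qed

lemma holomorphic_euler_phi: "euler_phi holomorphic_on ball 0 1"
proof (rule holomorphic_uniform_sequence)
  fix w :: complex assume "w \<in> ball 0 1"
  then obtain r where r: "norm w < r" "r < 1"
    using dense by auto
  have "0 \<le> r"
    using r norm_ge_zero[of w] by linarith
  have "cball w (r - norm w) \<subseteq> cball 0 r"
    by (auto simp: dist_norm) norm
  hence "uniform_limit (cball w (r - norm w)) (\<lambda>N w. \<Prod>n<N. 1 - w ^ Suc n) euler_phi sequentially"
    using uniform_limit_euler_phi[OF \<open>0 \<le> r\<close> r(2)] by (rule uniform_limit_on_subset[rotated])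
  moreover have "cball w (r - norm w) \<subseteq> ball 0 1"
    using \<open>cball w _ \<subseteq> _\<close> r by auto
  ultimately show "\<exists>d>0. cball w d \<subseteq> ball 0 1 \<and>
      uniform_limit (cball w d) (\<lambda>N w. \<Prod>n<N. 1 - w ^ Suc n) euler_phi sequentially"
    using r by (intro exI[of _ "r - norm w"]) auto
qed (auto intro!: holomorphic_intros)

text \<open>Uniform limits of holomorphic functions commute with taking Taylor coefficients, and the
  coefficients of the partial products stabilise at those of \<open>euler_fps\<close>.\<close>

lemma euler_phi_has_fps_expansion [fps_expansion_intros]:
  "euler_phi has_fps_expansion euler_fps"
proof -
  have *: "euler_phi has_fps_expansion fps_expansion euler_phi 0"
    by (rule has_fps_expansion_fps_expansion[OF _ _ holomorphic_euler_phi]) auto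
  have "fps_expansion euler_phi 0 = euler_fps"
  proof (rule uniform_limit_imp_fps_expansion_eq)
    show "((\<lambda>N. \<Prod>n<N. 1 - fps_X ^ Suc n) \<longlongrightarrow> (euler_fps :: complex fps)) sequentially"
      unfolding tendsto_fps_iff
    proof
      fix n
      show "\<forall>\<^sub>F N in sequentially. (\<Prod>n<N. 1 - fps_X ^ Suc n) $ n = (euler_fps :: complex fps) $ n"
        using eventually_ge_at_top[of n] by eventually_elim (simp add: euler_fps_nth)
    qed
    show "uniform_limit (ball 0 (1/2)) (\<lambda>N w. \<Prod>n<N. 1 - w ^ Suc n) euler_phi sequentially"
      by (rule uniform_limit_on_subset[OF uniform_limit_euler_phi[of "1/2"]]) auto
    show "\<forall>\<^sub>F N in sequentially. (\<lambda>w. \<Prod>n<N. 1 - w ^ Suc n) has_fps_expansion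
            (\<Prod>n<N. 1 - fps_X ^ Suc n :: complex fps)"
      by (intro always_eventually allI fps_expansion_intros)
    show "\<forall>\<^sub>F N in sequentially. (\<lambda>w. \<Prod>n<N. 1 - w ^ Suc n :: complex) holomorphic_on ball 0 (1/2)"
      by (intro always_eventually allI holomorphic_intros)
  qed (use * in auto)
  with * show ?thesis
    by simp
qed

section \<open>From Taylor series in the nome to q-expansions\<close>

lemma nome_neq_0 [simp]: "nome z \<noteq> 0"
  by (simp add: nome_def)

lemma norm_nome_less_1:
  assumes "Im z > 0"
  shows "norm (nome z) < 1"
  using assms by (simp add: nome_def)

lemma nome_mult_3: "nome (3 * z) = nome z ^ 3"
  by (simp add: nome_def algebra_simps flip: exp_of_nat_mult)

lemma q_coeff_eqI:
  assumes "has_q_expansion f F"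
  shows "q_coeff f n = fls_nth F n"
proof -
  have "(THE F. has_q_expansion f F) = F"
    using assms has_q_expansion_unique by blast
  thus ?thesis by (simp add: q_coeff_def)
qed

text \<open>Holomorphy on the whole unit disc forces radius of convergence at least 1, so the local
  expansion at 0 is valid at every value of the nome.\<close>

lemma has_q_expansion_simple_pole:
  assumes "h has_fps_expansion H" "h holomorphic_on ball 0 1"
  assumes "\<And>z. Im z > 0 \<Longrightarrow> f z = h (nome z) / nome z"
  shows "has_q_expansion f (fls_shift 1 (fps_to_fls H))"
  unfolding has_q_expansion_def
proof safe
  have "h holomorphic_on eball 0 1"
    using assms(2) by (simp add: one_ereal_def)
  from holomorphic_on_imp_fps_conv_radius_ge[OF assms(1) this]
  show ge: "1 \<le> fls_conv_radius (fls_shift 1 (fps_to_fls H))"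
    by simp
  fix z assume z: "Im z > 0"
  have "ereal (norm (nome z)) < 1"
    using norm_nome_less_1[OF z] by simp
  also have "1 \<le> fps_conv_radius H"
    using ge by simp
  finally have "eval_fls (fls_shift 1 (fps_to_fls H)) (nome z) = eval_fps H (nome z) / nome z"
    by (simp add: eval_fls_shift eval_fps_to_fls power_int_minus field_simps)
  also have "eval_fps H (nome z) = h (nome z)"
    using assms(1,2) norm_nome_less_1[OF z] by (intro has_fps_expansion_imp_eval_fps_eq) auto
  finally show "eval_fls (fls_shift 1 (fps_to_fls H)) (nome z) = f z"
    using assms(3)[OF z] by simp
qed

definition eta_fun :: "complex \<Rightarrow> complex" where
  "eta_fun w = (euler_phi w / euler_phi (w ^ 3)) ^ 12"

text \<open>The twelfth powers of the exponential prefactors are q^(1/2) and q^(3/2), whose quotient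
  is 1/q.\<close>

lemma eta_quotient_power12:
  "(dedekind_eta z / dedekind_eta (3 * z)) ^ 12 = eta_fun (nome z) / nome z"
proof -
  have "exp (2 * of_real pi * \<i> * z / 24) ^ 12 = exp (of_real pi * \<i> * z)"
    by (simp add: mult_ac flip: exp_of_nat_mult)
  moreover have "exp (2 * of_real pi * \<i> * (3 * z) / 24) ^ 12 = exp (of_real pi * \<i> * z) * nome z"
    unfolding nome_def by (simp add: algebra_simps flip: exp_of_nat_mult exp_add)
  ultimately show ?thesis
    unfolding dedekind_eta_def euler_phi_def [symmetric] nome_mult_3 eta_fun_def
    by (simp add: power_divide power_mult_distrib)
qed

lemma power_3_less_1: "norm (w::complex) < 1 \<Longrightarrow> norm (w ^ 3) < 1"
  by (simp add: norm_power power_less_one_iff)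

lemma holomorphic_euler_phi_cube: "(\<lambda>w. euler_phi (w ^ 3)) holomorphic_on ball 0 1"
proof -
  have "(\<lambda>w::complex. w ^ 3) ` ball 0 1 \<subseteq> ball 0 1"
    using power_3_less_1 by auto
  hence "(euler_phi \<circ> (\<lambda>w. w ^ 3)) holomorphic_on ball 0 1"
    by (intro holomorphic_on_compose_gen[OF _ holomorphic_euler_phi] holomorphic_intros)
  thus ?thesis
    by (simp add: o_def)
qed

lemma euler_phi_cube_has_fps_expansion [fps_expansion_intros]:
  "(\<lambda>w. euler_phi (w ^ 3)) has_fps_expansion (euler_fps oo fps_X ^ 3)"
proof -
  have "(euler_phi \<circ> (\<lambda>w. w ^ 3)) has_fps_expansion (euler_fps oo fps_X ^ 3)"
    by (intro fps_expansion_intros) auto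
  thus ?thesis by (simp add: o_def)
qed

lemma inverse_euler_phi_cube_has_fps_expansion:
  "(\<lambda>w. inverse (euler_phi (w ^ 3))) has_fps_expansion fps_of_int euler_cube_inv_fps"
proof -
  have "(\<lambda>w. inverse (euler_phi (w ^ 3))) has_fps_expansion inverse (euler_fps oo fps_X ^ 3)"
    by (intro fps_expansion_intros) auto
  also have "inverse (euler_fps oo fps_X ^ 3) = (fps_of_int euler_cube_inv_fps :: complex fps)"
    using fps_of_int_euler_cube_inv by (metis fps_inverse_unique mult.commute)
  finally show ?thesis .
qed

lemma inverse_euler_phi_has_fps_expansion:
  "(\<lambda>w. inverse (euler_phi w)) has_fps_expansion fps_of_int euler_inv_fps"
proof -
  have "(\<lambda>w. inverse (euler_phi w)) has_fps_expansion inverse euler_fps"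
    by (intro fps_expansion_intros) auto
  also have "inverse euler_fps = (fps_of_int euler_inv_fps :: complex fps)"
    using fps_of_int_euler_inv by (metis fps_inverse_unique mult.commute)
  finally show ?thesis .
qed

lemma eta_fun_has_fps_expansion: "eta_fun has_fps_expansion fps_of_int eta_quotient_fps"
  unfolding eta_fun_def eta_quotient_fps_def fps_of_int_power fps_of_int_mult fps_of_int_euler divide_inverse
  by (intro fps_expansion_intros inverse_euler_phi_cube_has_fps_expansion)

lemma inverse_eta_fun_has_fps_expansion:
  "(\<lambda>w. inverse (eta_fun w)) has_fps_expansion fps_of_int eta_quotient_inv_fps"
proof -
  have "(\<lambda>w. (euler_phi (w ^ 3) * inverse (euler_phi w)) ^ 12) has_fps_expansion fps_of_int eta_quotient_inv_fps"
    unfolding eta_quotient_inv_fps_def fps_of_int_power fps_of_int_mult fps_of_int_euler fps_of_int_compose fps_of_int_X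
    by (intro fps_expansion_intros inverse_euler_phi_has_fps_expansion)
  thus ?thesis
    by (simp add: eta_fun_def field_simps)
qed

lemma holomorphic_eta_fun: "eta_fun holomorphic_on ball 0 1"
  unfolding eta_fun_def
  by (intro holomorphic_intros holomorphic_euler_phi holomorphic_euler_phi_cube)
     (auto intro!: euler_phi_nonzero power_3_less_1)

lemma eta_fun_nonzero: "norm w < 1 \<Longrightarrow> eta_fun w \<noteq> 0"
  by (simp add: eta_fun_def euler_phi_nonzero power_3_less_1)

section \<open>Integrality and parity of the coefficients\<close>

lemma a3_plus_eq: "a3_plus (int m - 1) = of_int (eta_quotient_fps $ m)"
proof -
  have "has_q_expansion f3_plus (fls_shift 1 (fps_to_fls (fps_of_int eta_quotient_fps)))"
    by (rule has_q_expansion_simple_pole[OF eta_fun_has_fps_expansion holomorphic_eta_fun])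
       (simp add: f3_plus_def eta_quotient_power12)
  thus ?thesis
    by (simp add: a3_plus_def q_coeff_eqI)
qed

lemma c3_plus_eq:
  assumes "m \<ge> 2"
  shows "c3_plus (int m - 1) = of_int (eta_quotient_fps $ m + 3 ^ 6 * eta_quotient_inv_fps $ (m - 2))"
proof -
  \<comment> \<open>This is q * \<open>j3_plus\<close> as a function of q. The constant 12 moves to
    degree 1, below the range \<open>m >= 2\<close>, and the reciprocal eta quotient starts at
    degree 2.\<close>
  define h where "h w = eta_fun w + 12 * w + 3 ^ 6 * (w ^ 2 * inverse (eta_fun w))" for w
  define H where "H = fps_of_int eta_quotient_fps + 12 * fps_X + 3 ^ 6 * (fps_X ^ 2 * (fps_of_int eta_quotient_inv_fps :: complex fps))"
  have "has_q_expansion j3_plus (fls_shift 1 (fps_to_fls H))"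
  proof (rule has_q_expansion_simple_pole)
    show "h has_fps_expansion H"
      unfolding h_def H_def
      by (intro fps_expansion_intros eta_fun_has_fps_expansion inverse_eta_fun_has_fps_expansion)
    show "h holomorphic_on ball 0 1"
      unfolding h_def
      by (intro holomorphic_intros holomorphic_eta_fun) (auto simp: eta_fun_nonzero)
    fix z assume "Im z > 0"
    have "(dedekind_eta (3 * z) / dedekind_eta z) ^ 12 =
            inverse ((dedekind_eta z / dedekind_eta (3 * z)) ^ 12)"
      by (simp add: field_simps)
    also have "\<dots> = nome z * inverse (eta_fun (nome z))"
      unfolding eta_quotient_power12 by (simp add: divide_inverse)
    finally show "j3_plus z = h (nome z) / nome z"
      by (simp add: j3_plus_def h_def eta_quotient_power12 add_divide_distrib power2_eq_square)
  qed
  hence "c3_plus (int m - 1) = H $ m"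
    by (simp add: c3_plus_def q_coeff_eqI)
  also have "\<dots> = of_int (eta_quotient_fps $ m + 3 ^ 6 * eta_quotient_inv_fps $ (m - 2))"
    using assms by (simp add: H_def fps_X_power_mult_nth fps_numeral_nth)
  finally show ?thesis .
qed

lemma a3_plus_parity:
  "odd (eta_quotient_fps $ m) \<Longrightarrow> odd_integer (a3_plus (int m - 1))"
  "even (eta_quotient_fps $ m) \<Longrightarrow> even_integer (a3_plus (int m - 1))"
  unfolding odd_integer_def even_integer_def a3_plus_eq by blast+

lemma c3_plus_parity:
  assumes "m > 0"
  shows "odd (eta_quotient_fps $ (4 * m)) \<Longrightarrow> odd_integer (c3_plus (4 * int m - 1))"
    and "even (eta_quotient_fps $ (4 * m)) \<Longrightarrow> even_integer (c3_plus (4 * int m - 1))"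
proof -
  \<comment> \<open>Positivity of \<open>m\<close> prevents truncated subtraction, so the index is 2
    modulo 4.\<close>
  have "\<not> 4 dvd 4 * m - 2"
    using assms by presburger
  hence *: "even (eta_quotient_inv_fps $ (4 * m - 2))"
    by (rule even_eta_quotient_inv_nth)
  have "c3_plus (int (4 * m) - 1) =
      of_int (eta_quotient_fps $ (4 * m) + 3 ^ 6 * eta_quotient_inv_fps $ (4 * m - 2))"
    using assms by (intro c3_plus_eq) auto
  hence c3: "c3_plus (4 * int m - 1) =
      of_int (eta_quotient_fps $ (4 * m) + 3 ^ 6 * eta_quotient_inv_fps $ (4 * m - 2))"
    by simp
  show "odd_integer (c3_plus (4 * int m - 1))" if "odd (eta_quotient_fps $ (4 * m))"
    unfolding odd_integer_def c3 using that * by (metis even_add even_mult_iff)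
  show "even_integer (c3_plus (4 * int m - 1))" if "even (eta_quotient_fps $ (4 * m))"
    unfolding even_integer_def c3 using that * by (metis even_add even_mult_iff)
qed

section \<open>Infinitely many parameters and the final theorem\<close>

text \<open>Products \<open>l * (l + 1)\<close> are 0, 1 or 2 modulo 5. This gives whole residue
  classes of \<open>t\<close> for which the non-representability hypotheses hold.\<close>

lemma mult_Suc_mod_5_neq_3: "l * (l + 1) mod 5 \<noteq> (3 :: nat)"
proof -
  have "l mod 5 \<in> {0, 1, 2, 3, 4}"
    by (simp, presburger)
  moreover have "l * (l + 1) mod 5 = (l mod 5) * (l mod 5 + 1) mod 5"
    by (intro mod_mult_cong) (simp_all add: mod_simps)
  ultimately show ?thesis
    by auto
qed

lemma infinite_int_if_unbounded:
  fixes A :: "int set"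
  assumes "\<And>k::nat. \<exists>n\<in>A. int k < n"
  shows "infinite A"
proof
  assume "finite A"
  then obtain B where B: "\<And>n. n \<in> A \<Longrightarrow> n \<le> B"
    using bdd_above_finite unfolding bdd_above_def by blast
  from assms[of "nat B"] obtain n where "n \<in> A" "int (nat B) < n"
    by blast
  with B[of n] show False
    by linarith
qed

lemma infinite_odd_c3_plus:
  "infinite {n::int. n > 0 \<and> [n = 3] (mod 4) \<and> odd_integer (c3_plus n)}"
proof (rule infinite_int_if_unbounded)
  fix k :: nat
  \<comment> \<open>For \<open>t\<close> congruent to 2 modulo 5, \<open>3 * t * (t + 1)\<close> is
    congruent to 18, hence to 3.\<close>
  define t where "t = 5 * k + 2"
  have "3 * t * (t + 1) = 5 * (15 * k\<^sup>2 + 15 * k + 3) + 3"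
    by (simp add: t_def power2_eq_square algebra_simps)
  hence "3 * t * (t + 1) mod 5 = 3"
    by presburger
  hence "\<nexists>l::nat. 3 * t * (t + 1) = l * (l + 1)"
    by (metis mult_Suc_mod_5_neq_3)
  then obtain m where m: "m \<ge> 3 * t" "odd (eta_quotient_fps $ (4 * m))"
    using ex_odd_eta_quotient by (meson atLeastAtMost_iff)
  show "\<exists>n\<in>{n::int. n > 0 \<and> [n = 3] (mod 4) \<and> odd_integer (c3_plus n)}. int k < n"
  proof (intro bexI[of _ "4 * int m - 1"] CollectI conjI)
    show "[4 * int m - 1 = 3] (mod 4)"
      unfolding cong_def by presburger
    show "odd_integer (c3_plus (4 * int m - 1))"
      using m by (intro c3_plus_parity) (auto simp: t_def)
  qed (use m in \<open>auto simp: t_def\<close>)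
qed

lemma infinite_even_c3_plus:
  "infinite {n::int. n > 0 \<and> [n = 3] (mod 4) \<and> even_integer (c3_plus n)}"
proof (rule infinite_int_if_unbounded)
  fix k :: nat
  \<comment> \<open>For \<open>t\<close> congruent to 1 modulo 5, \<open>6 * t * (2 * t + 1)\<close>
    is congruent to 18, hence to 3.\<close>
  define t where "t = 5 * k + 1"
  have "6 * t * (2 * t + 1) = 5 * (60 * k\<^sup>2 + 30 * k + 3) + 3"
    by (simp add: t_def power2_eq_square algebra_simps)
  hence "6 * t * (2 * t + 1) mod 5 = 3"
    by presburger
  hence "\<nexists>l::nat. 6 * t * (2 * t + 1) = l * (l + 1)"
    by (metis mult_Suc_mod_5_neq_3)
  then obtain m where m: "m \<ge> 6 * t" "even (eta_quotient_fps $ (4 * m))"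
    using ex_even_eta_quotient by (meson atLeastAtMost_iff)
  show "\<exists>n\<in>{n::int. n > 0 \<and> [n = 3] (mod 4) \<and> even_integer (c3_plus n)}. int k < n"
  proof (intro bexI[of _ "4 * int m - 1"] CollectI conjI)
    show "[4 * int m - 1 = 3] (mod 4)"
      unfolding cong_def by presburger
    show "even_integer (c3_plus (4 * int m - 1))"
      using m by (intro c3_plus_parity) (auto simp: t_def)
  qed (use m in \<open>auto simp: t_def\<close>)
qed

theorem theorem3p1:
  shows "(\<forall>t::nat. t > 0 \<longrightarrow>
            (\<nexists>l::nat. 3 * t * (t + 1) = l * (l + 1)) \<longrightarrow>
            (\<exists>n::int. n \<in> {12 * int t - 1 .. 6 * int t * (int t + 1) - 1} \<and>
                      [n = 3] (mod 4) \<and> odd_integer (a3_plus n)))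
       \<and> (\<forall>t::nat. t > 0 \<longrightarrow>
            (\<nexists>l::nat. 6 * t * (2 * t + 1) = l * (l + 1)) \<longrightarrow>
            (\<exists>n::int. n \<in> {24 * int t - 1 .. 12 * int t * (2 * int t + 1) - 1} \<and>
                      [n = 3] (mod 4) \<and> even_integer (a3_plus n)))
       \<and> infinite {n::int. n > 0 \<and> [n = 3] (mod 4) \<and> even_integer (c3_plus n)}
       \<and> infinite {n::int. n > 0 \<and> [n = 3] (mod 4) \<and> odd_integer (c3_plus n)}"
proof (intro conjI allI impI)
  fix t :: nat
  assume "\<nexists>l::nat. 3 * t * (t + 1) = l * (l + 1)"
  then obtain m where m: "3 * t \<le> m" "m \<le> 3 * triangle t" "odd (eta_quotient_fps $ (4 * m))"
    using ex_odd_eta_quotient by (meson atLeastAtMost_iff)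
  \<comment> \<open>With \<open>n = 4 * m - 1\<close>, the bounds \<open>3 * t\<close> and
    \<open>3 * triangle t\<close> on \<open>m\<close> become exactly the ends of the stated
    interval.\<close>
  have "4 * m \<le> 6 * (t * (t + 1))"
    using m(2) two_triangle[of t] by linarith
  hence "int (4 * m) \<le> int (6 * (t * (t + 1)))"
    by (simp only: of_nat_le_iff)
  hence "int (4 * m) - 1 \<in> {12 * int t - 1..6 * int t * (int t + 1) - 1}"
    using m(1) by (simp add: algebra_simps)
  moreover have "[int (4 * m) - 1 = 3] (mod 4)"
    unfolding cong_def by presburger
  ultimately show "\<exists>n. n \<in> {12 * int t - 1..6 * int t * (int t + 1) - 1} \<and>
      [n = 3] (mod 4) \<and> odd_integer (a3_plus n)"
    using a3_plus_parity(1)[OF m(3)] by blast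
next
  fix t :: nat
  assume "\<nexists>l::nat. 6 * t * (2 * t + 1) = l * (l + 1)"
  then obtain m where
    m: "6 * t \<le> m" "m \<le> 3 * triangle (2 * t)" "even (eta_quotient_fps $ (4 * m))"
    using ex_even_eta_quotient by (meson atLeastAtMost_iff)
  have "4 * m \<le> 6 * (2 * t * (2 * t + 1))"
    using m(2) two_triangle[of "2 * t"] by linarith
  hence "int (4 * m) \<le> int (6 * (2 * t * (2 * t + 1)))"
    by (simp only: of_nat_le_iff)
  hence "int (4 * m) - 1 \<in> {24 * int t - 1..12 * int t * (2 * int t + 1) - 1}"
    using m(1) by (simp add: algebra_simps)
  moreover have "[int (4 * m) - 1 = 3] (mod 4)"
    unfolding cong_def by presburger
  ultimately show "\<exists>n. n \<in> {24 * int t - 1..12 * int t * (2 * int t + 1) - 1} \<and>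
      [n = 3] (mod 4) \<and> even_integer (a3_plus n)"
    using a3_plus_parity(2)[OF m(3)] by blast
qed (rule infinite_even_c3_plus infinite_odd_c3_plus)+

end
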